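(* (The Second H-isomorphism Theorem) Let $P$ be an H-group, let $M$ and $N$ be saturated sub-H-groups of $P$, and suppose $N$ is normal in $P$. Then there is an isomorphism of groups $$M/(M\cap N)\;\cong\;\widetilde{MN}/N .$$
   Context: An H-group $(P,\mu,\eta,c)$ is a pointed space $(P,p_0)$ with continuous pointed maps $\mu:P\times P\to P$, $\eta:P\to P$ and the constant map $c:P\to P$ at $p_0$ such that, via pointed homotopies, $\mu(1_P,c)\simeq\mu(c,1_P)\simeq 1_P$, $\mu(\eta,1_P)\simeq\mu(1_P,\eta)\simeq c$ and $\mu(\mu\times 1_P)\simeq\mu(1_P\times\mu)$. Write $g.h=\mu(g,h)$ and $g^{-1}=\eta(g)$. An H-homomorphism between H-groups $(P,\mu,\eta,c)$ and $(Q,\mu_2,\eta_2,c_2)$ is a continuous map $\varphi:P\to Q$ with $\varphi\mu\simeq\mu_2(\varphi\times\varphi)$ and $\varphi\eta\simeq\eta_2\varphi$. A sub-H-group of $P$ is a pointed subspace $P'\ni p_0$ which is itself an H-group (with base point $p_0$) such that the inclusion $P'\to P$ is an H-homomorphism. A subset $A\subseteq P$ is saturated if it contains the path component in $P$ of each of its points. For $A\subseteq P$ and $g\in P$, write $g\,\widetilde{\in}\,A$ if there is a path in $P$ from $g$ to a point of $A$; put $\widetilde{A}=\{g\in P\mid g\,\widetilde{\in}\,A\}$. For $A,B\subseteq P$, $AB=\{a.b\mid a\in A,b\in B\}$ and $\widetilde{AB}$ is its saturation. The left coset of a sub-H-group $P'$ is $gP'=\{g'\in P\mid g^{-1}.g'\,\widetilde{\in}\,P'\}$.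 A sub-H-group $P'$ is normal if $g.g'.g^{-1}\,\widetilde{\in}\,P'$ for all $g\in P$, $g'\in P'$; then $P/P'=\{gP'\mid g\in P\}$ is a group under $(g_1P').(g_2P')=(g_1.g_2)P'$. In the situation of the claim, $M\cap N$ is a normal sub-H-group of $M$, $\widetilde{MN}$ is a sub-H-group of $P$, and $N$ is a normal sub-H-group of $\widetilde{MN}$, so that both quotients are groups. *)

theory Defs
  imports "HOL-Analysis.Homotopy" "HOL-Algebra.Group"
begin

record 'a hgroup =
  hspace :: "'a topology"
  hbase :: 'a
  hmult :: "'a \<Rightarrow> 'a \<Rightarrow> 'a"
  hinv :: "'a \<Rightarrow> 'a"

abbreviation hpoints :: "'a hgroup \<Rightarrow> 'a set" where
  "hpoints P \<equiv> topspace (hspace P)"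

definition pointed_map ::
  "'a topology \<Rightarrow> 'a \<Rightarrow> 'b topology \<Rightarrow> 'b \<Rightarrow> ('a \<Rightarrow> 'b) \<Rightarrow> bool" where
  "pointed_map X x0 Y y0 f \<longleftrightarrow> continuous_map X Y f \<and> f x0 = y0"

definition pointed_homotopic ::
  "'a topology \<Rightarrow> 'a \<Rightarrow> 'b topology \<Rightarrow> 'b \<Rightarrow> ('a \<Rightarrow> 'b) \<Rightarrow> ('a \<Rightarrow> 'b) \<Rightarrow> bool" where
  "pointed_homotopic X x0 Y y0 f g \<longleftrightarrow> homotopic_with (\<lambda>k. k x0 = y0) X Y f g"

text \<open>The constant map \<open>c\<close> is determined by the base point, so it is not a field of the record.
  As usual, \<open>\<mu>(f, g)\<close> is the map sending \<open>x\<close> to \<open>\<mu>(f x, g x)\<close>.  The values of \<open>hmult\<close> and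
  \<open>hinv\<close> outside the space are irrelevant.\<close>

definition H_group :: "'a hgroup \<Rightarrow> bool" where
  "H_group P \<longleftrightarrow>
    (let X = hspace P; p = hbase P; \<mu> = hmult P; \<eta> = hinv P; c = (\<lambda>x. p) in
      p \<in> topspace X \<and>
      pointed_map (prod_topology X X) (p, p) X p (\<lambda>(x, y). \<mu> x y) \<and>
      pointed_map X p X p \<eta> \<and>
      pointed_homotopic X p X p (\<lambda>x. \<mu> x (c x)) (\<lambda>x. x) \<and>
      pointed_homotopic X p X p (\<lambda>x. \<mu> (c x) x) (\<lambda>x. x) \<and>
      pointed_homotopic X p X p (\<lambda>x. \<mu> (\<eta> x) x) c \<and>
      pointed_homotopic X p X p (\<lambda>x. \<mu> x (\<eta> x)) c \<and>
      pointed_homotopic (prod_topology X (prod_topology X X)) (p, p, p) X p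
        (\<lambda>(x, y, z). \<mu> (\<mu> x y) z) (\<lambda>(x, y, z). \<mu> x (\<mu> y z)))"

text \<open>The homotopies in the following definition are not required to preserve base points.\<close>

definition H_homomorphism :: "'a hgroup \<Rightarrow> 'b hgroup \<Rightarrow> ('a \<Rightarrow> 'b) \<Rightarrow> bool" where
  "H_homomorphism P Q \<phi> \<longleftrightarrow>
    continuous_map (hspace P) (hspace Q) \<phi> \<and>
    homotopic_with (\<lambda>_. True) (prod_topology (hspace P) (hspace P)) (hspace Q)
      (\<lambda>(x, y). \<phi> (hmult P x y)) (\<lambda>(x, y). hmult Q (\<phi> x) (\<phi> y)) \<and>
    homotopic_with (\<lambda>_. True) (hspace P) (hspace Q)
      (\<lambda>x. \<phi> (hinv P x)) (\<lambda>x. hinv Q (\<phi> x))"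

text \<open>A sub-H-group \<open>S\<close> carries operations of its own, which agree with those of \<open>P\<close> only up to
  homotopy in \<open>P\<close>.\<close>

definition sub_H_group :: "'a hgroup \<Rightarrow> 'a hgroup \<Rightarrow> bool" where
  "sub_H_group S P \<longleftrightarrow>
    H_group S \<and>
    hspace S = subtopology (hspace P) (hpoints S) \<and>
    hbase S = hbase P \<and>
    H_homomorphism S P (\<lambda>x. x)"

definition H_restrict :: "'a hgroup \<Rightarrow> 'a set \<Rightarrow> 'a hgroup" where
  "H_restrict P A = P\<lparr>hspace := subtopology (hspace P) A\<rparr>"

definition path_mem :: "'a hgroup \<Rightarrow> 'a \<Rightarrow> 'a set \<Rightarrow> bool" where
  "path_mem P g A \<longleftrightarrow> (\<exists>a\<in>A. path_component_of (hspace P) g a)"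

definition saturation :: "'a hgroup \<Rightarrow> 'a set \<Rightarrow> 'a set" where
  "saturation P A = {g \<in> hpoints P. path_mem P g A}"

definition saturated :: "'a hgroup \<Rightarrow> 'a set \<Rightarrow> bool" where
  "saturated P A \<longleftrightarrow>
    A \<subseteq> hpoints P \<and> (\<forall>a\<in>A. path_component_of_set (hspace P) a \<subseteq> A)"

definition H_set_mult :: "'a hgroup \<Rightarrow> 'a set \<Rightarrow> 'a set \<Rightarrow> 'a set" where
  "H_set_mult P A B = {hmult P a b | a b. a \<in> A \<and> b \<in> B}"

definition H_coset :: "'a hgroup \<Rightarrow> 'a \<Rightarrow> 'a hgroup \<Rightarrow> 'a set" where
  "H_coset P g S = {g' \<in> hpoints P. path_mem P (hmult P (hinv P g) g') (hpoints S)}"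

definition normal_sub_H_group :: "'a hgroup \<Rightarrow> 'a hgroup \<Rightarrow> bool" where
  "normal_sub_H_group S P \<longleftrightarrow>
    sub_H_group S P \<and>
    (\<forall>g\<in>hpoints P. \<forall>g'\<in>hpoints S.
      path_mem P (hmult P (hmult P g g') (hinv P g)) (hpoints S))"

text \<open>The product of two cosets is the one coset that arises as \<open>(g\<^sub>1.g\<^sub>2)S\<close> from representatives;
  it is meaningful (independent of the representatives) when \<open>S\<close> is normal in \<open>P\<close>.\<close>

definition H_quotient :: "'a hgroup \<Rightarrow> 'a hgroup \<Rightarrow> 'a set monoid" where
  "H_quotient P S =
    \<lparr>carrier = {H_coset P g S | g. g \<in> hpoints P},
     monoid.mult = (\<lambda>A B. THE C. \<exists>g1\<in>hpoints P. \<exists>g2\<in>hpoints P.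
        A = H_coset P g1 S \<and> B = H_coset P g2 S \<and> C = H_coset P (hmult P g1 g2) S),
     one = H_coset P (hbase P) S\<rparr>"

end

theory Submission
  imports Defs "HOL-Algebra.Coset"
begin

text \<open>
  Everything factors through the group \<open>\<pi>\<^sub>0(P)\<close> of path components.  The saturated sub-H-group \<open>N\<close>
  is a union of components and corresponds to a normal subgroup \<open>K\<close> of \<open>\<pi>\<^sub>0(P)\<close>; let
  \<open>f : P \<rightarrow> \<pi>\<^sub>0(P)/K\<close> be the projection.  It is multiplicative, constant on path components, and
  \<open>f x = 1\<close> exactly when \<open>x \<in> N\<close>.  Restricted to \<open>M\<close>, where it is also multiplicative for the
  operation of \<open>M\<close>, it identifies \<open>M/(M \<inter> N)\<close> with \<open>f(M)\<close>; restricted to the saturation of \<open>MN\<close>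
  it identifies the other quotient with \<open>f(MN) = f(M)\<close>.
\<close>

section \<open>Homotopies and path components\<close>

lemma path_component_of_prod:
  "path_component_of (prod_topology X Y) (x, y) (x', y') \<longleftrightarrow>
    path_component_of X x x' \<and> path_component_of Y y y'"
  by (metis mem_Collect_eq mem_Sigma_iff path_component_of_pair)

lemma path_component_of_unit_interval:
  assumes "s \<in> {0..1::real}" "t \<in> {0..1}" "x \<in> topspace X"
  shows "path_component_of (prod_topology (top_of_set {0..1}) X) (s, x) (t, x)"
proof -
  have "path_component {0..1::real} s t"
    using assms convex_imp_path_connected[of "{0..1::real}"] by (auto simp: path_connected_component)
  then show ?thesis
    using assms(3) by (simp add: path_component_of_prod path_component_of_refl)
qed

text \<open>The track of \<open>x\<close> under the homotopy is a path from \<open>f x\<close> to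
  \<open>g x\<close>. Through this lemma the homotopies in the definitions of H-group and
  H-homomorphism become identities between path components.\<close>

lemma homotopic_with_imp_path_component_of:
  assumes "homotopic_with Q X Y f g" and "x \<in> topspace X"
  shows "path_component_of Y (f x) (g x)"
proof -
  obtain h where h: "continuous_map (prod_topology (top_of_set {0..1::real}) X) Y h"
    "\<And>x. h (0, x) = f x" "\<And>x. h (1, x) = g x"
    using assms(1) by (auto simp: homotopic_with_def)
  have "path_component_of Y (h (0, x)) (h (1, x))"
  proof (rule path_component_of_continuous_image[OF h(1)])
    show "path_component_of (prod_topology (top_of_set {0..1::real}) X) (0, x) (1, x)"
      using assms(2) by (intro path_component_of_unit_interval) auto
  qed
  then show ?thesis by (simp add: h)
qed

text \<open>Under a homotopy each point travels along a path, so a point that starts in a set closed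
  under path components never leaves it. The homotopy itself is unchanged and therefore still
  satisfies \<open>Q\<close>; only its starting map \<open>f\<close> has to be checked to send
  \<open>S\<close> into \<open>A\<close>.\<close>

lemma homotopic_with_subtopology_saturated:
  assumes hom: "homotopic_with Q X Y f g"
    and sat: "\<And>a. a \<in> A \<Longrightarrow> path_component_of_set Y a \<subseteq> A"
    and f: "\<And>x. x \<in> topspace X \<Longrightarrow> x \<in> S \<Longrightarrow> f x \<in> A"
  shows "homotopic_with Q (subtopology X S) (subtopology Y A) f g"
proof -
  let ?I = "top_of_set {0..1::real}"
  obtain h where h: "continuous_map (prod_topology ?I X) Y h"
    "\<And>x. h (0, x) = f x" "\<And>x. h (1, x) = g x" "\<And>t. t \<in> {0..1} \<Longrightarrow> Q (\<lambda>x. h (t, x))"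
    using hom by (auto simp: homotopic_with_def)
  have mem: "h (t, x) \<in> A" if "t \<in> {0..1}" "x \<in> topspace X" "x \<in> S" for t x
  proof -
    have "path_component_of Y (h (0, x)) (h (t, x))"
      using that by (intro path_component_of_continuous_image[OF h(1)] path_component_of_unit_interval) auto
    then show ?thesis using sat[OF f[OF that(2,3)]] by (auto simp: h)
  qed
  have "continuous_map (prod_topology ?I (subtopology X S)) Y h"
    unfolding prod_topology_subtopology(2)[of ?I] by (rule continuous_map_from_subtopology[OF h(1)])
  then have "continuous_map (prod_topology ?I (subtopology X S)) (subtopology Y A) h"
    using mem by (auto simp: continuous_map_in_subtopology)
  then show ?thesis
    unfolding homotopic_with_def using h by blast
qed

lemma saturated_path_component:
  assumes "saturated P A" "a \<in> A" "path_component_of (hspace P) a b"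
  shows "b \<in> A"
  using assms by (auto simp: saturated_def)

text \<open>Turns the path conditions in cosets and in normality into plain membership.\<close>

lemma path_mem_saturated:
  assumes "saturated P A" "x \<in> hpoints P"
  shows "path_mem P x A \<longleftrightarrow> x \<in> A"
  using assms saturated_path_component[OF assms(1)]
  by (metis path_component_of_refl path_component_of_sym path_mem_def)

lemma saturated_saturation: "saturated P (saturation P A)"
  unfolding saturated_def saturation_def path_mem_def
  by (auto dest: path_component_in_topspace intro: path_component_of_trans path_component_of_sym)

lemma path_component_of_subtopology:
  "path_component_of (subtopology X S) x y \<Longrightarrow> path_component_of X x y"
  by (auto simp: path_component_of_def pathin_subtopology)

section \<open>The group of path components\<close>

lemma H_group_simps:
  "H_group P \<longleftrightarrow> hbase P \<in> hpoints P \<and>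
    continuous_map (prod_topology (hspace P) (hspace P)) (hspace P) (\<lambda>(x, y). hmult P x y) \<and>
    hmult P (hbase P) (hbase P) = hbase P \<and>
    continuous_map (hspace P) (hspace P) (hinv P) \<and> hinv P (hbase P) = hbase P \<and>
    pointed_homotopic (hspace P) (hbase P) (hspace P) (hbase P) (\<lambda>x. hmult P x (hbase P)) (\<lambda>x. x) \<and>
    pointed_homotopic (hspace P) (hbase P) (hspace P) (hbase P) (\<lambda>x. hmult P (hbase P) x) (\<lambda>x. x) \<and>
    pointed_homotopic (hspace P) (hbase P) (hspace P) (hbase P)
      (\<lambda>x. hmult P (hinv P x) x) (\<lambda>x. hbase P) \<and>
    pointed_homotopic (hspace P) (hbase P) (hspace P) (hbase P)
      (\<lambda>x. hmult P x (hinv P x)) (\<lambda>x. hbase P) \<and>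
    pointed_homotopic (prod_topology (hspace P) (prod_topology (hspace P) (hspace P)))
      (hbase P, hbase P, hbase P) (hspace P) (hbase P)
      (\<lambda>(x, y, z). hmult P (hmult P x y) z) (\<lambda>(x, y, z). hmult P x (hmult P y z))"
  by (simp add: H_group_def pointed_map_def Let_def)

context
  fixes P :: "'a hgroup"
  assumes P: "H_group P"
begin

lemma hbase_closed: "hbase P \<in> hpoints P"
  using P by (simp add: H_group_simps)

lemma hmult_closed:
  assumes "x \<in> hpoints P" "y \<in> hpoints P"
  shows "hmult P x y \<in> hpoints P"
proof -
  have "(\<lambda>(x, y). hmult P x y) \<in> hpoints P \<times> hpoints P \<rightarrow> hpoints P"
    using P by (simp add: H_group_simps continuous_map_def)
  then show ?thesis using funcset_mem[of _ _ _ "(x, y)"] assms by fastforce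
qed

lemma hinv_closed: "x \<in> hpoints P \<Longrightarrow> hinv P x \<in> hpoints P"
  using P by (auto simp: H_group_simps continuous_map_def)

text \<open>A pair of paths is a path in the product space, and the continuous multiplication
  carries it to a path. Hence multiplication descends to components.\<close>

lemma hmult_path:
  assumes "path_component_of (hspace P) x x'" "path_component_of (hspace P) y y'"
  shows "path_component_of (hspace P) (hmult P x y) (hmult P x' y')"
  using path_component_of_continuous_image[of "prod_topology (hspace P) (hspace P)" "hspace P"
      "\<lambda>(x, y). hmult P x y" "(x, y)" "(x', y')"] P assms
  by (auto simp: H_group_simps path_component_of_prod)

text \<open>This and the next two lemmas supply the laws that \<open>groupI\<close> asks for: left
  unit, left inverses and associativity, each read off pointwise from a homotopy.\<close>

lemma hbase_hmult_path:
  "x \<in> hpoints P \<Longrightarrow> path_component_of (hspace P) (hmult P (hbase P) x) x"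
  using P homotopic_with_imp_path_component_of[of _ _ _ "\<lambda>x. hmult P (hbase P) x" "\<lambda>x. x" x]
  by (auto simp: H_group_simps pointed_homotopic_def)

lemma hinv_hmult_path:
  "x \<in> hpoints P \<Longrightarrow> path_component_of (hspace P) (hmult P (hinv P x) x) (hbase P)"
  using P homotopic_with_imp_path_component_of[of _ _ _ "\<lambda>x. hmult P (hinv P x) x" "\<lambda>x. hbase P" x]
  by (auto simp: H_group_simps pointed_homotopic_def)

lemma hmult_assoc_path:
  assumes "x \<in> hpoints P" "y \<in> hpoints P" "z \<in> hpoints P"
  shows "path_component_of (hspace P) (hmult P (hmult P x y) z) (hmult P x (hmult P y z))"
  using P assms homotopic_with_imp_path_component_of[of _ _ _
      "\<lambda>(x, y, z). hmult P (hmult P x y) z" "\<lambda>(x, y, z). hmult P x (hmult P y z)" "(x, y, z)"]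
  by (auto simp: H_group_simps pointed_homotopic_def)

end

abbreviation component :: "'a hgroup \<Rightarrow> 'a \<Rightarrow> 'a set" where
  "component P x \<equiv> path_component_of_set (hspace P) x"

text \<open>The set product of two components may be a proper part of a component. Saturating it
  gives a product that involves no choice of representatives.\<close>

definition pi0 :: "'a hgroup \<Rightarrow> 'a set monoid" where
  "pi0 P = \<lparr>carrier = component P ` hpoints P,
    monoid.mult = (\<lambda>A B. saturation P (H_set_mult P A B)), one = component P (hbase P)\<rparr>"

text \<open>Here \<open>y\<close> is arbitrary: outside the space its component is empty, and both
  sides are false.\<close>

lemma component_eq:
  assumes "x \<in> hpoints P"
  shows "component P x = component P y \<longleftrightarrow> path_component_of (hspace P) x y"
  using assms by (metis mem_Collect_eq path_component_of_equiv path_component_of_refl)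

context
  fixes P :: "'a hgroup"
  assumes P: "H_group P"
begin

text \<open>By \<open>hmult_path\<close> all products of points of the two components lie in one
  component, and saturating the set of these products yields exactly that component.\<close>

lemma component_hmult:
  assumes "x \<in> hpoints P" "y \<in> hpoints P"
  shows "component P x \<otimes>\<^bsub>pi0 P\<^esub> component P y = component P (hmult P x y)"
proof (rule Set.set_eqI)
  fix z
  have "z \<in> component P x \<otimes>\<^bsub>pi0 P\<^esub> component P y \<longleftrightarrow>
    (\<exists>a b. path_component_of (hspace P) x a \<and> path_component_of (hspace P) y b \<and>
      path_component_of (hspace P) z (hmult P a b))"
    by (auto simp: pi0_def saturation_def path_mem_def H_set_mult_def
        dest: path_component_in_topspace)
  also have "\<dots> \<longleftrightarrow> path_component_of (hspace P) (hmult P x y) z"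
    using assms
    by (meson P hmult_path path_component_of_refl path_component_of_sym path_component_of_trans)
  finally show "z \<in> component P x \<otimes>\<^bsub>pi0 P\<^esub> component P y \<longleftrightarrow> z \<in> component P (hmult P x y)"
    by simp
qed

lemma group_pi0: "group (pi0 P)"
proof (rule groupI)
  note simps = component_hmult component_eq hmult_closed[OF P] hbase_closed[OF P] hinv_closed[OF P]
  have carrier: "carrier (pi0 P) = component P ` hpoints P"
    and one: "\<one>\<^bsub>pi0 P\<^esub> = component P (hbase P)"
    by (simp_all add: pi0_def)
  show "\<one>\<^bsub>pi0 P\<^esub> \<in> carrier (pi0 P)"
    by (auto simp: carrier one hbase_closed[OF P])
  fix A assume "A \<in> carrier (pi0 P)"
  then obtain x where x: "x \<in> hpoints P" "A = component P x" by (auto simp: carrier)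
  show "\<one>\<^bsub>pi0 P\<^esub> \<otimes>\<^bsub>pi0 P\<^esub> A = A"
    using x hbase_hmult_path[OF P] by (simp add: one simps)
  show "\<exists>B\<in>carrier (pi0 P). B \<otimes>\<^bsub>pi0 P\<^esub> A = \<one>\<^bsub>pi0 P\<^esub>"
    using x hinv_hmult_path[OF P]
    by (intro bexI[of _ "component P (hinv P x)"]) (auto simp: one simps carrier)
  fix B assume "B \<in> carrier (pi0 P)"
  then obtain y where y: "y \<in> hpoints P" "B = component P y" by (auto simp: carrier)
  show "A \<otimes>\<^bsub>pi0 P\<^esub> B \<in> carrier (pi0 P)"
    using x y by (auto simp: carrier simps)
  fix C assume "C \<in> carrier (pi0 P)"
  then obtain z where z: "z \<in> hpoints P" "C = component P z" by (auto simp: carrier)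
  show "A \<otimes>\<^bsub>pi0 P\<^esub> B \<otimes>\<^bsub>pi0 P\<^esub> C = A \<otimes>\<^bsub>pi0 P\<^esub> (B \<otimes>\<^bsub>pi0 P\<^esub> C)"
    using x y z hmult_assoc_path[OF P] by (simp add: simps)
qed

lemma component_in_pi0: "x \<in> hpoints P \<Longrightarrow> component P x \<in> carrier (pi0 P)"
  by (simp add: pi0_def)

lemma component_hinv:
  assumes "x \<in> hpoints P"
  shows "component P (hinv P x) = inv\<^bsub>pi0 P\<^esub> component P x"
proof (rule group.inv_equality[OF group_pi0, symmetric])
  show "component P (hinv P x) \<otimes>\<^bsub>pi0 P\<^esub> component P x = \<one>\<^bsub>pi0 P\<^esub>"
    using assms hinv_hmult_path[OF P assms]
    \<comment> \<open>Unfolding \<open>pi0_def\<close> is left to a second call, since it would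
      rewrite the product before \<open>component_hmult\<close> could apply.\<close>
    by (simp add: component_hmult hinv_closed[OF P] hmult_closed[OF P] component_eq)
      (simp add: pi0_def hmult_closed[OF P] hinv_closed[OF P] component_eq)
qed (use assms in \<open>simp_all add: component_in_pi0 hinv_closed[OF P]\<close>)

end

section \<open>Sub-H-groups\<close>

lemma hspace_H_restrict [simp]: "hspace (H_restrict P A) = subtopology (hspace P) A"
  and hbase_H_restrict [simp]: "hbase (H_restrict P A) = hbase P"
  and hmult_H_restrict [simp]: "hmult (H_restrict P A) = hmult P"
  and hinv_H_restrict [simp]: "hinv (H_restrict P A) = hinv P"
  by (simp_all add: H_restrict_def)

text \<open>All homotopies of the H-group axioms restrict to \<open>A\<close> because
  \<open>A\<close> is saturated. The inclusion commutes strictly with the operations, so constant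
  homotopies make it an H-homomorphism. Both the saturation of \<open>MN\<close> in \<open>P\<close>
  and the intersection in \<open>M\<close> arise in this way.\<close>

lemma sub_H_group_H_restrict:
  assumes P: "H_group P" and sat: "saturated P A" and base: "hbase P \<in> A"
    and mult: "\<And>x y. x \<in> A \<Longrightarrow> y \<in> A \<Longrightarrow> hmult P x y \<in> A"
    and inv: "\<And>x. x \<in> A \<Longrightarrow> hinv P x \<in> A"
  shows "sub_H_group (H_restrict P A) P"
proof -
  let ?X = "hspace P" and ?A = "subtopology (hspace P) A"
  have A: "A \<subseteq> topspace ?X" and sat': "\<And>a. a \<in> A \<Longrightarrow> path_component_of_set ?X a \<subseteq> A"
    using sat by (auto simp: saturated_def)
  \<comment> \<open>Domains are put into the form of a subspace of a product, as the restriction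
    lemma requires. The second equation has its inner product already rewritten by the first, since
    rewriting goes from the inside out.\<close>
  have prod: "prod_topology ?A ?A = subtopology (prod_topology ?X ?X) (A \<times> A)"
    "prod_topology ?A (subtopology (prod_topology ?X ?X) (A \<times> A)) =
      subtopology (prod_topology ?X (prod_topology ?X ?X)) (A \<times> A \<times> A)"
    by (simp_all add: subtopology_Times)
  note restrict = homotopic_with_subtopology_saturated[OF _ sat']
  have cont: "continuous_map (prod_topology ?A ?A) ?A (\<lambda>(x, y). hmult P x y)"
    "continuous_map ?A ?A (hinv P)"
    using P mult inv
    by (auto simp: H_group_simps prod continuous_map_in_subtopology continuous_map_from_subtopology)
  then have H: "H_group (H_restrict P A)"
    using P A base mult inv
    by (auto simp: H_group_simps pointed_homotopic_def prod intro!: restrict)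
  have "continuous_map (prod_topology ?A ?A) ?X (\<lambda>(x, y). hmult P x y)"
    "continuous_map ?A ?X (hinv P)"
    using cont by (simp_all add: continuous_map_in_subtopology)
  then have "H_homomorphism (H_restrict P A) P (\<lambda>x. x)"
    by (simp add: H_homomorphism_def continuous_map_from_subtopology)
  then show ?thesis
    using H A by (simp add: sub_H_group_def inf.absorb2)
qed

text \<open>The homotopies in \<open>P\<close> that compare the operations of \<open>S\<close> with
  those of \<open>P\<close> start in \<open>S\<close>, hence in \<open>A\<close>, and so stay in
  \<open>A\<close>. This makes \<open>N\<close>, with its own operations, a sub-H-group of the
  saturation of \<open>MN\<close>.\<close>

lemma sub_H_group_mono:
  assumes S: "sub_H_group S P" and sat: "saturated P A" and sub: "hpoints S \<subseteq> A"
  shows "sub_H_group S (H_restrict P A)"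
proof -
  have sat': "\<And>a. a \<in> A \<Longrightarrow> path_component_of_set (hspace P) a \<subseteq> A"
    using sat by (auto simp: saturated_def)
  have eq: "hspace S = subtopology (subtopology (hspace P) A) (hpoints S)"
    using S sub by (metis sub_H_group_def subtopology_subtopology inf.absorb2)
  have H: "H_group S" and hom: "H_homomorphism S P (\<lambda>x. x)"
    using S by (auto simp: sub_H_group_def)
  \<comment> \<open>With \<open>S = UNIV\<close> only the codomain of the homotopies is cut
    down.\<close>
  note restrict = homotopic_with_subtopology_saturated[OF _ sat', where S = UNIV, simplified]
  have "H_homomorphism S (H_restrict P A) (\<lambda>x. x)"
    using hom sub hmult_closed[OF H] hinv_closed[OF H]
    by (auto simp: H_homomorphism_def continuous_map_in_subtopology intro!: restrict)
  then show ?thesis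
    using S eq by (simp add: sub_H_group_def)
qed

context
  fixes P S :: "'a hgroup"
  assumes S: "sub_H_group S P"
begin

lemma sub_H_group_H_group: "H_group S"
  and sub_H_group_hbase: "hbase S = hbase P"
  using S by (auto simp: sub_H_group_def)

lemma sub_H_group_hspace: "hspace S = subtopology (hspace P) (hpoints S)"
  using S by (simp add: sub_H_group_def)

lemma sub_H_group_subset: "hpoints S \<subseteq> hpoints P"
  by (metis inf_le1 sub_H_group_hspace topspace_subtopology)

lemma sub_H_group_path:
  "path_component_of (hspace S) x y \<Longrightarrow> path_component_of (hspace P) x y"
  by (metis sub_H_group_hspace path_component_of_subtopology)

text \<open>A path in \<open>S\<close> is also a path in \<open>P\<close>, so it cannot leave
  \<open>A\<close>.\<close>

lemma saturated_sub_H_group_Int: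
  assumes "saturated P A"
  shows "saturated S (hpoints S \<inter> A)"
  unfolding saturated_def
  using saturated_path_component[OF assms] sub_H_group_path path_component_in_topspace[of "hspace S"]
  by blast

lemma sub_H_group_hmult_path:
  assumes "x \<in> hpoints S" "y \<in> hpoints S"
  shows "path_component_of (hspace P) (hmult S x y) (hmult P x y)"
  using S assms homotopic_with_imp_path_component_of[of _ _ _
      "\<lambda>(x, y). hmult S x y" "\<lambda>(x, y). hmult P x y" "(x, y)"]
  by (auto simp: sub_H_group_def H_homomorphism_def)

lemma sub_H_group_hinv_path:
  assumes "x \<in> hpoints S"
  shows "path_component_of (hspace P) (hinv S x) (hinv P x)"
  using S assms homotopic_with_imp_path_component_of[of _ _ _ "hinv S" "hinv P" x]
  by (auto simp: sub_H_group_def H_homomorphism_def)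

text \<open>The product formed in \<open>S\<close> lies in \<open>S\<close> and is joined by a path
  to the product formed in \<open>P\<close>; saturation brings the latter into \<open>S\<close> as
  well.\<close>

lemma saturated_sub_H_group_hmult:
  assumes "saturated P (hpoints S)" "x \<in> hpoints S" "y \<in> hpoints S"
  shows "hmult P x y \<in> hpoints S"
  using assms hmult_closed[OF sub_H_group_H_group] sub_H_group_hmult_path saturated_path_component
  by metis

lemma saturated_sub_H_group_hinv:
  assumes "saturated P (hpoints S)" "x \<in> hpoints S"
  shows "hinv P x \<in> hpoints S"
  using assms hinv_closed[OF sub_H_group_H_group] sub_H_group_hinv_path saturated_path_component
  by metis

end

lemma subgroup_component_image:
  assumes P: "H_group P" and S: "sub_H_group S P" and sat: "saturated P (hpoints S)"
  shows "subgroup (component P ` hpoints S) (pi0 P)"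
proof (rule group.subgroupI[OF group_pi0[OF P]])
  have sub: "x \<in> hpoints P" if "x \<in> hpoints S" for x
    using that sub_H_group_subset[OF S] by auto
  show "component P ` hpoints S \<subseteq> carrier (pi0 P)"
    using sub by (auto simp: pi0_def)
  show "component P ` hpoints S \<noteq> {}"
    using hbase_closed[OF sub_H_group_H_group[OF S]] by auto
  fix A assume "A \<in> component P ` hpoints S"
  then obtain x where x: "x \<in> hpoints S" "A = component P x" by auto
  then show "inv\<^bsub>pi0 P\<^esub> A \<in> component P ` hpoints S"
    using component_hinv[OF P] saturated_sub_H_group_hinv[OF S sat] sub by (metis imageI)
  fix B assume "B \<in> component P ` hpoints S"
  then obtain y where y: "y \<in> hpoints S" "B = component P y" by auto
  show "A \<otimes>\<^bsub>pi0 P\<^esub> B \<in> component P ` hpoints S"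
    using x y component_hmult[OF P] saturated_sub_H_group_hmult[OF S sat] sub by (metis imageI)
qed

text \<open>A saturated set is a union of components, so passing to components loses no information
  about it.\<close>

lemma component_in_component_image:
  assumes "saturated P A" "x \<in> hpoints P"
  shows "component P x \<in> component P ` A \<longleftrightarrow> x \<in> A"
  using assms component_eq saturated_path_component path_component_of_sym
  by (smt (verit, ccfv_threshold) image_iff)

lemma normal_component_image:
  assumes P: "H_group P" and S: "normal_sub_H_group S P" and sat: "saturated P (hpoints S)"
  shows "component P ` hpoints S \<lhd> pi0 P"
proof (rule group.normal_invI[OF group_pi0[OF P]])
  have sub: "sub_H_group S P" using S by (simp add: normal_sub_H_group_def)
  then show "subgroup (component P ` hpoints S) (pi0 P)"
    using P sat by (intro subgroup_component_image)
  fix A B assume "A \<in> carrier (pi0 P)" "B \<in> component P ` hpoints S"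
  then obtain g s where g: "g \<in> hpoints P" "A = component P g"
    and s: "s \<in> hpoints S" "B = component P s"
    by (auto simp: pi0_def)
  have s': "s \<in> hpoints P" using s sub_H_group_subset[OF sub] by auto
  have mem: "hmult P (hmult P g s) (hinv P g) \<in> hpoints S"
    using S g(1) s(1) s' path_mem_saturated[OF sat] hmult_closed[OF P] hinv_closed[OF P]
    unfolding normal_sub_H_group_def by metis
  have "A \<otimes>\<^bsub>pi0 P\<^esub> B \<otimes>\<^bsub>pi0 P\<^esub> inv\<^bsub>pi0 P\<^esub> A = component P (hmult P (hmult P g s) (hinv P g))"
    using g s s' by (simp add: component_hmult[OF P] hmult_closed[OF P] hinv_closed[OF P]
        flip: component_hinv[OF P])
  then show "A \<otimes>\<^bsub>pi0 P\<^esub> B \<otimes>\<^bsub>pi0 P\<^esub> inv\<^bsub>pi0 P\<^esub> A \<in> component P ` hpoints S"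
    using mem by simp
qed

section \<open>Quotients\<close>

text \<open>A first isomorphism theorem: \<open>f\<close> induces a homomorphism onto
  \<open>G\<close> from the group of components, and its kernel consists of the points joined to
  \<open>S\<close>. The cosets of \<open>S\<close> are then the fibres of \<open>f\<close>, and the
  group structure of the quotient is transported from \<open>G\<close>. Both quotients of the
  theorem are handled by it, with the same \<open>f\<close> and the same target.\<close>

lemma H_quotient_iso:
  assumes Q: "H_group Q" and G: "group G"
    and surj: "f ` hpoints Q = carrier G"
    and path: "\<And>x y. path_component_of (hspace Q) x y \<Longrightarrow> f x = f y"
    and mult: "\<And>x y. x \<in> hpoints Q \<Longrightarrow> y \<in> hpoints Q \<Longrightarrow> f (hmult Q x y) = f x \<otimes>\<^bsub>G\<^esub> f y"
    and ker: "\<And>x. x \<in> hpoints Q \<Longrightarrow> path_mem Q x (hpoints S) \<longleftrightarrow> f x = \<one>\<^bsub>G\<^esub>"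
  shows "group (H_quotient Q S) \<and> H_quotient Q S \<cong> G"
proof -
  interpret group G by (rule G)
  \<comment> \<open>This is the inverse of the map that \<open>f\<close> induces on cosets; working
    from \<open>G\<close> towards cosets avoids choosing representatives.\<close>
  define h where "h y = {x \<in> hpoints Q. f x = y}" for y
  have closed: "f x \<in> carrier G" if "x \<in> hpoints Q" for x
    using that surj by auto
  \<comment> \<open>The base point is strictly idempotent, so its image is an idempotent of the
    group \<open>G\<close>.\<close>
  have base: "f (hbase Q) = \<one>\<^bsub>G\<^esub>"
    using mult[OF hbase_closed[OF Q] hbase_closed[OF Q]] Q closed[OF hbase_closed[OF Q]]
    by (simp add: H_group_simps)
  have inv: "f (hinv Q x) = inv\<^bsub>G\<^esub> f x" if "x \<in> hpoints Q" for x
    using path[OF hinv_hmult_path[OF Q that]] that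
    by (intro inv_equality[symmetric]) (auto simp: mult base hinv_closed[OF Q] closed)
  have coset: "H_coset Q g S = h (f g)" if g: "g \<in> hpoints Q" for g
  proof -
    have "path_mem Q (hmult Q (hinv Q g) x) (hpoints S) \<longleftrightarrow> f x = f g" if x: "x \<in> hpoints Q" for x
    proof -
      have "path_mem Q (hmult Q (hinv Q g) x) (hpoints S) \<longleftrightarrow> inv\<^bsub>G\<^esub> f g \<otimes>\<^bsub>G\<^esub> f x = \<one>\<^bsub>G\<^esub>"
        using g x by (simp add: ker mult inv hinv_closed[OF Q] hmult_closed[OF Q])
      also have "\<dots> \<longleftrightarrow> f x = f g"
        using g x closed inv_solve_left'[of "\<one>\<^bsub>G\<^esub>" "f g" "f x"] by simp
      finally show ?thesis .
    qed
    then show ?thesis by (auto simp: H_coset_def h_def)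
  qed
  \<comment> \<open>Fibres over distinct points are disjoint, and by surjectivity of
    \<open>f\<close> none of them is empty.\<close>
  have inj: "inj_on h (carrier G)"
  proof (rule inj_onI)
    fix a b assume "a \<in> carrier G" "b \<in> carrier G" "h a = h b"
    moreover obtain x where "x \<in> hpoints Q" "f x = a"
      using \<open>a \<in> carrier G\<close> surj by force
    ultimately show "a = b" by (auto simp: h_def)
  qed
  have carrier: "carrier (H_quotient Q S) = h ` carrier G"
    unfolding surj[symmetric] by (force simp: H_quotient_def coset)
  have hom: "h (a \<otimes>\<^bsub>G\<^esub> b) = h a \<otimes>\<^bsub>H_quotient Q S\<^esub> h b"
    if ab: "a \<in> carrier G" "b \<in> carrier G" for a b
  proof -
    \<comment> \<open>The description is well defined: if \<open>x\<close> and \<open>y\<close>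
      represent \<open>h a\<close> and \<open>h b\<close>, then injectivity of \<open>h\<close>
      forces \<open>f x = a\<close> and \<open>f y = b\<close>, so every choice yields the same
      product coset.\<close>
    have "(THE C. \<exists>g1\<in>hpoints Q. \<exists>g2\<in>hpoints Q.
        h a = H_coset Q g1 S \<and> h b = H_coset Q g2 S \<and> C = H_coset Q (hmult Q g1 g2) S) = h (a \<otimes>\<^bsub>G\<^esub> b)"
    proof (rule the_equality)
      obtain x y where "x \<in> hpoints Q" "f x = a" "y \<in> hpoints Q" "f y = b"
        using ab by (auto simp flip: surj)
      then show "\<exists>g1\<in>hpoints Q. \<exists>g2\<in>hpoints Q. h a = H_coset Q g1 S \<and> h b = H_coset Q g2 S \<and>
          h (a \<otimes>\<^bsub>G\<^esub> b) = H_coset Q (hmult Q g1 g2) S"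
        by (intro bexI[of _ x] bexI[of _ y]) (auto simp: coset mult hmult_closed[OF Q])
    next
      fix C assume "\<exists>g1\<in>hpoints Q. \<exists>g2\<in>hpoints Q. h a = H_coset Q g1 S \<and> h b = H_coset Q g2 S \<and>
          C = H_coset Q (hmult Q g1 g2) S"
      then obtain x y where "x \<in> hpoints Q" "y \<in> hpoints Q" "h a = h (f x)" "h b = h (f y)"
        "C = h (f x \<otimes>\<^bsub>G\<^esub> f y)"
        by (auto simp: coset mult hmult_closed[OF Q])
      then show "C = h (a \<otimes>\<^bsub>G\<^esub> b)"
        by (simp add: inj_on_eq_iff[OF inj] ab closed)
    qed
    then show ?thesis by (simp add: H_quotient_def)
  qed
  have iso: "h \<in> iso G (H_quotient Q S)"
    using inj carrier by (auto simp: iso_def bij_betw_def hom intro!: homI)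
  \<comment> \<open>The rule \<open>iso_imp_img_group\<close> gives a group whose unit is replaced
    by the image of the unit; here the two units coincide.\<close>
  have "H_quotient Q S\<lparr>one := h \<one>\<^bsub>G\<^esub>\<rparr> = H_quotient Q S"
    by (simp add: H_quotient_def coset hbase_closed[OF Q] base)
  then have "group (H_quotient Q S)"
    using iso_imp_img_group[OF iso] by simp
  moreover have "H_quotient Q S \<cong> G"
    using iso is_isoI iso_sym by blast
  ultimately show ?thesis by blast
qed

theorem theorem4p7:
  fixes P M N :: "'a hgroup"
  defines "MN \<equiv> H_restrict P (saturation P (H_set_mult P (hpoints M) (hpoints N)))"
    and "M_inter_N \<equiv> H_restrict M (hpoints M \<inter> hpoints N)"
  assumes "H_group P"
    and "sub_H_group M P" and "saturated P (hpoints M)"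
    and "sub_H_group N P" and "saturated P (hpoints N)"
    and "normal_sub_H_group N P"
  shows "normal_sub_H_group M_inter_N M \<and> sub_H_group MN P \<and> normal_sub_H_group N MN \<and>
    group (H_quotient M M_inter_N) \<and> group (H_quotient MN N) \<and>
    H_quotient M M_inter_N \<cong> H_quotient MN N"
proof -
  note P = assms(3) and M = assms(4) and satM = assms(5) and N = assms(6) and satN = assms(7)
    and normal = assms(8)
  note closed = hbase_closed[OF P] hmult_closed[OF P] hinv_closed[OF P]
  have HM: "H_group M" and HN: "H_group N"
    using M N by (auto simp: sub_H_group_def)
  have MP: "\<And>x. x \<in> hpoints M \<Longrightarrow> x \<in> hpoints P" and NP: "\<And>x. x \<in> hpoints N \<Longrightarrow> x \<in> hpoints P"
    using sub_H_group_subset[OF M] sub_H_group_subset[OF N] by auto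

  \<comment> \<open>The projection \<open>f\<close> of \<open>P\<close> onto the quotient group and
    its kernel\<close>
  define K where "K = component P ` hpoints N"
  define G where "G = pi0 P Mod K"
  define f where "f x = K #>\<^bsub>pi0 P\<^esub> component P x" for x
  interpret \<pi>: group "pi0 P" by (rule group_pi0[OF P])
  interpret K: normal K "pi0 P"
    unfolding K_def by (rule normal_component_image[OF P normal satN])
  interpret G: group G
    unfolding G_def by (rule K.factorgroup_is_group)
  have f_closed: "f x \<in> carrier G" if "x \<in> hpoints P" for x
    using that hom_in_carrier[OF K.r_coset_hom_Mod component_in_pi0[OF P that]]
    by (simp add: f_def G_def)
  have f_path: "f x = f y" if "path_component_of (hspace P) x y" for x y
    using that component_eq path_component_in_topspace by (metis f_def)
  have f_mult: "f (hmult P x y) = f x \<otimes>\<^bsub>G\<^esub> f y" if "x \<in> hpoints P" "y \<in> hpoints P" for x y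
    using hom_mult[OF K.r_coset_hom_Mod component_in_pi0[OF P that(1)] component_in_pi0[OF P that(2)]]
    by (simp add: f_def G_def component_hmult[OF P that])
  have f_ker: "f x = \<one>\<^bsub>G\<^esub> \<longleftrightarrow> x \<in> hpoints N" if "x \<in> hpoints P" for x
  proof -
    have "f x = \<one>\<^bsub>G\<^esub> \<longleftrightarrow> component P x \<in> K"
      using \<pi>.coset_join1[OF _ component_in_pi0[OF P that] K.subgroup_axioms]
        \<pi>.coset_join2[OF component_in_pi0[OF P that] K.subgroup_axioms]
      by (auto simp: f_def G_def FactGroup_def)
    then show ?thesis
      by (simp add: K_def component_in_component_image[OF satN that])
  qed
  \<comment> \<open>The product of \<open>hinv P x\<close> and \<open>x\<close> is joined to the
    base point, which lies in \<open>N\<close> and so is sent to the unit.\<close>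
  have f_inv: "f (hinv P x) = inv\<^bsub>G\<^esub> f x" if "x \<in> hpoints P" for x
    using f_path[OF hinv_hmult_path[OF P that]] that hbase_closed[OF HN] sub_H_group_hbase[OF N]
    by (intro G.inv_equality[symmetric])
      (auto simp: f_mult f_closed closed f_ker simp flip: f_mult)
  have f_base: "f (hbase P) = \<one>\<^bsub>G\<^esub>"
    using hbase_closed[OF HN] by (simp add: f_ker closed sub_H_group_hbase[OF N])

  \<comment> \<open>The common target of both quotients\<close>
  define H where "H = G\<lparr>carrier := f ` hpoints M\<rparr>"
  have subH: "subgroup (f ` hpoints M) G"
  proof (rule G.subgroupI)
    show "f ` hpoints M \<subseteq> carrier G" "f ` hpoints M \<noteq> {}"
      using MP f_closed hbase_closed[OF HM] by auto
    fix a assume "a \<in> f ` hpoints M"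
    then obtain x where x: "x \<in> hpoints M" "a = f x" by auto
    then show "inv\<^bsub>G\<^esub> a \<in> f ` hpoints M"
      using f_inv MP saturated_sub_H_group_hinv[OF M satM] by (metis imageI)
    fix b assume "b \<in> f ` hpoints M"
    then obtain y where y: "y \<in> hpoints M" "b = f y" by auto
    show "a \<otimes>\<^bsub>G\<^esub> b \<in> f ` hpoints M"
      using x y f_mult MP saturated_sub_H_group_hmult[OF M satM] by (metis imageI)
  qed
  have groupH: "group H"
    unfolding H_def by (rule subgroup.subgroup_is_group[OF subH G.group_axioms])

  \<comment> \<open>The saturation of \<open>MN\<close> and its quotient by \<open>N\<close>\<close>
  define A where "A = saturation P (H_set_mult P (hpoints M) (hpoints N))"
  have MN_def': "MN = H_restrict P A" by (simp add: MN_def A_def)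
  have satA: "saturated P A" unfolding A_def by (rule saturated_saturation)
  have AP: "A \<subseteq> hpoints P" using satA by (simp add: saturated_def)
  have A_iff: "x \<in> A \<longleftrightarrow> f x \<in> f ` hpoints M" if x: "x \<in> hpoints P" for x
  proof
    assume "x \<in> A"
    then obtain m n where m: "m \<in> hpoints M" and n: "n \<in> hpoints N"
      and "path_component_of (hspace P) x (hmult P m n)"
      by (auto simp: A_def saturation_def path_mem_def H_set_mult_def)
    then have "f x = f m \<otimes>\<^bsub>G\<^esub> f n" using f_path f_mult MP NP by metis
    also have "f n = \<one>\<^bsub>G\<^esub>" using n f_ker NP by simp
    finally show "f x \<in> f ` hpoints M" using m f_closed MP by auto
  next
    assume "f x \<in> f ` hpoints M"
    then obtain m where m: "m \<in> hpoints M" "f x = f m" by auto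
    \<comment> \<open>This \<open>n\<close> is the factor by which \<open>x\<close> differs from
      \<open>m\<close>. It lies in \<open>N\<close> because \<open>f x = f m\<close>, and a
      computation in \<open>pi0 P\<close> shows that the product of \<open>m\<close> and
      \<open>n\<close> is joined to \<open>x\<close>.\<close>
    define n where "n = hmult P (hinv P m) x"
    have mP: "m \<in> hpoints P" and nP: "n \<in> hpoints P" using m MP x closed by (auto simp: n_def)
    have "f n = \<one>\<^bsub>G\<^esub>"
      using m mP x f_closed by (simp add: n_def f_mult f_inv closed)
    then have n: "n \<in> hpoints N" using f_ker nP by simp
    have "component P (hmult P m n) = component P x"
      using mP x by (simp add: n_def closed component_in_pi0[OF P] component_hinv[OF P]
          \<pi>.inv_solve_left flip: component_hmult[OF P] \<pi>.m_assoc)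
    then have "path_component_of (hspace P) x (hmult P m n)"
      using x component_eq by metis
    then show "x \<in> A"
      using m n x by (auto simp: A_def saturation_def path_mem_def H_set_mult_def)
  qed
  have A_f: "x \<in> hpoints P" "f x \<in> f ` hpoints M" if "x \<in> A" for x
    using that AP A_iff by auto
  have A_base: "hbase P \<in> A"
    and A_mult: "\<And>x y. x \<in> A \<Longrightarrow> y \<in> A \<Longrightarrow> hmult P x y \<in> A"
    and A_inv: "\<And>x. x \<in> A \<Longrightarrow> hinv P x \<in> A"
    using subgroup.one_closed[OF subH] subgroup.m_closed[OF subH] subgroup.m_inv_closed[OF subH]
    by (simp_all add: A_iff[OF closed(1)] A_iff[OF closed(2)] A_iff[OF closed(3)]
        A_f f_base f_mult f_inv)
  have subMN: "sub_H_group MN P"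
    unfolding MN_def' by (rule sub_H_group_H_restrict[OF P satA A_base A_mult A_inv])
  have pointsMN: "hpoints MN = A" using AP by (auto simp: MN_def')
  have NA: "hpoints N \<subseteq> A"
    using NP f_ker subgroup.one_closed[OF subH] A_iff by (metis subsetI)
  have NMN: "sub_H_group N MN"
    unfolding MN_def' by (rule sub_H_group_mono[OF N satA NA])
  have satNMN: "saturated MN (hpoints N)"
    using saturated_sub_H_group_Int[OF subMN satN] NA pointsMN by (simp add: inf.absorb2)
  have normalMN: "normal_sub_H_group N MN"
    unfolding normal_sub_H_group_def
  proof (intro conjI NMN ballI)
    fix g n assume g: "g \<in> hpoints MN" and n: "n \<in> hpoints N"
    have gn: "g \<in> hpoints P" "n \<in> hpoints P" using g n pointsMN AP NP by auto
    \<comment> \<open>The operations of \<open>MN\<close> are literally those of \<open>P\<close>,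
      so conjugates in \<open>MN\<close> are conjugates in \<open>P\<close>.\<close>
    have mem: "hmult P (hmult P g n) (hinv P g) \<in> hpoints N"
      using normal gn n closed path_mem_saturated[OF satN] unfolding normal_sub_H_group_def by metis
    then show "path_mem MN (hmult MN (hmult MN g n) (hinv MN g)) (hpoints N)"
      using path_mem_saturated[OF satNMN] NA pointsMN by (auto simp: MN_def')
  qed
  have quotMN: "group (H_quotient MN N) \<and> H_quotient MN N \<cong> H"
  proof (rule H_quotient_iso[OF _ groupH, of _ f])
    show "H_group MN" using sub_H_group_H_group[OF subMN] .
    have "f ` A = f ` hpoints M"
    proof (intro equalityI subsetI)
      fix a assume "a \<in> f ` hpoints M"
      then obtain m where "m \<in> hpoints M" "a = f m" by auto
      then show "a \<in> f ` A" using A_iff MP by blast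
    qed (use A_iff AP in auto)
    then show "f ` hpoints MN = carrier H" by (simp add: pointsMN H_def)
    show "f x = f y" if "path_component_of (hspace MN) x y" for x y
      using that sub_H_group_path[OF subMN] f_path by blast
    show "f (hmult MN x y) = f x \<otimes>\<^bsub>H\<^esub> f y" if "x \<in> hpoints MN" "y \<in> hpoints MN" for x y
    proof -
      have "x \<in> hpoints P" "y \<in> hpoints P" using that pointsMN AP by auto
      then show ?thesis by (simp add: MN_def' H_def f_mult)
    qed
    show "path_mem MN x (hpoints N) \<longleftrightarrow> f x = \<one>\<^bsub>H\<^esub>" if "x \<in> hpoints MN" for x
      using that path_mem_saturated[OF satNMN that] pointsMN AP f_ker by (auto simp: H_def)
  qed

  \<comment> \<open>The intersection of \<open>M\<close> and \<open>N\<close> and the quotient of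
    \<open>M\<close> by it\<close>
  define B where "B = hpoints M \<inter> hpoints N"
  have MB_def: "M_inter_N = H_restrict M B" by (simp add: M_inter_N_def B_def)
  have satB: "saturated M B"
    unfolding B_def by (rule saturated_sub_H_group_Int[OF M satN])
  \<comment> \<open>The operations of \<open>M\<close> agree with those of \<open>P\<close> only up
    to paths, and \<open>f\<close> does not see this difference.\<close>
  have f_mult': "f (hmult M x y) = f x \<otimes>\<^bsub>G\<^esub> f y" if "x \<in> hpoints M" "y \<in> hpoints M" for x y
    using f_path[OF sub_H_group_hmult_path[OF M that]] f_mult MP that by simp
  have f_inv': "f (hinv M x) = inv\<^bsub>G\<^esub> f x" if "x \<in> hpoints M" for x
    using f_path[OF sub_H_group_hinv_path[OF M that]] f_inv MP that by simp
  have B_iff: "x \<in> B \<longleftrightarrow> f x = \<one>\<^bsub>G\<^esub>" if "x \<in> hpoints M" for x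
    using that f_ker MP by (simp add: B_def)
  have BM: "\<And>x. x \<in> B \<Longrightarrow> x \<in> hpoints M" by (simp add: B_def)
  have pointsB: "hpoints M_inter_N = B" using BM by (auto simp: MB_def)
  note closedM = hbase_closed[OF HM] hmult_closed[OF HM] hinv_closed[OF HM]
  have subB: "sub_H_group M_inter_N M"
    unfolding MB_def
  proof (rule sub_H_group_H_restrict[OF HM satB])
    show "hbase M \<in> B" using f_base closedM by (simp add: B_iff sub_H_group_hbase[OF M])
    show "hinv M x \<in> B" if "x \<in> B" for x
    proof -
      have "x \<in> hpoints M" using that by (rule BM)
      then show ?thesis using that by (simp add: B_iff f_inv' closedM)
    qed
    show "hmult M x y \<in> B" if "x \<in> B" "y \<in> B" for x y
    proof -
      have "x \<in> hpoints M" "y \<in> hpoints M" using that BM by auto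
      then show ?thesis using that by (simp add: B_iff f_mult' closedM)
    qed
  qed
  have normalB: "normal_sub_H_group M_inter_N M"
    unfolding normal_sub_H_group_def
  proof (intro conjI subB ballI)
    fix g n assume g: "g \<in> hpoints M" and "n \<in> hpoints M_inter_N"
    then have n: "n \<in> hpoints M" "f n = \<one>\<^bsub>G\<^esub>" using pointsB BM B_iff by auto
    \<comment> \<open>Within \<open>M\<close> the set \<open>B\<close> is the kernel of
      \<open>f\<close>, so normality reduces to the conjugate having trivial image.\<close>
    have "f (hmult M (hmult M g n) (hinv M g)) = \<one>\<^bsub>G\<^esub>"
      using g n f_closed MP by (simp add: f_mult' f_inv' closedM)
    then show "path_mem M (hmult M (hmult M g n) (hinv M g)) (hpoints M_inter_N)"
      using g n closedM by (simp add: pointsB path_mem_saturated[OF satB] B_iff)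
  qed
  have quotB: "group (H_quotient M M_inter_N) \<and> H_quotient M M_inter_N \<cong> H"
  proof (rule H_quotient_iso[OF HM groupH, of f])
    show "f ` hpoints M = carrier H" by (simp add: H_def)
    show "f x = f y" if "path_component_of (hspace M) x y" for x y
      using that sub_H_group_path[OF M] f_path by blast
    show "f (hmult M x y) = f x \<otimes>\<^bsub>H\<^esub> f y" if "x \<in> hpoints M" "y \<in> hpoints M" for x y
      using that by (simp add: H_def f_mult')
    show "path_mem M x (hpoints M_inter_N) \<longleftrightarrow> f x = \<one>\<^bsub>H\<^esub>" if "x \<in> hpoints M" for x
      using that by (simp add: pointsB path_mem_saturated[OF satB] B_iff H_def)
  qed
  have "H_quotient M M_inter_N \<cong> H_quotient MN N"
    using quotB quotMN iso_trans group.iso_sym by blast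
  then show ?thesis
    using normalB subMN normalMN quotB quotMN by blast
qed

end
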